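(* For every function $f:\mathbb{N}_0\to\mathbb{N}_0$ there exists a sequence of natural numbers $\{a_n\}_{n=0}^\infty$ such that every positive integer has a unique $f$-decomposition using $\{a_n\}$.
   Context: $\mathbb{N}_0=\{0,1,2,\dots\}$, and natural numbers are positive integers. Given $f:\mathbb{N}_0\to\mathbb{N}_0$ and a sequence $\{a_n\}_{n=0}^\infty$, an $f$-decomposition of $x$ using $\{a_n\}$ is a finite sum $x=\sum_{i} a_{n_i}$ of terms of the sequence with pairwise distinct indices $n_i\ge 0$, such that for every $a_{n_i}$ in the sum, the previous $f(n_i)$ terms $a_{n_i-f(n_i)},a_{n_i-f(n_i)+1},\dots,a_{n_i-1}$ (those among them with index $\ge 0$) are not in the sum. Two $f$-decompositions are the same if they use the same set of indices. *)

theory Defs imports Main begin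

text \<open>
  A decomposition is represented by its index set \<open>S\<close>, so indices are automatically
  pairwise distinct and two decompositions are equal iff they use the same indices.
  The condition \<open>n \<le> j + f n\<close> says \<open>j \<ge> n - f n\<close> without truncated subtraction;
  as \<open>j\<close> ranges over the naturals, only terms with nonnegative index are constrained.
\<close>

definition f_decomposition ::
    "(nat \<Rightarrow> nat) \<Rightarrow> (nat \<Rightarrow> nat) \<Rightarrow> nat \<Rightarrow> nat set \<Rightarrow> bool" where
  "f_decomposition f a x S \<longleftrightarrow>
     finite S \<and> x = (\<Sum>n\<in>S. a n) \<and>
     (\<forall>n\<in>S. \<forall>j. n \<le> j + f n \<and> j < n \<longrightarrow> j \<notin> S)"

end

theory Submission imports Defs begin

text \<open>
  Take \<open>a n\<close> to be the number of admissible index sets contained in \<open>{0, \<dots>, n - 1}\<close>.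
  An admissible set with largest index \<open>n\<close> is \<open>n\<close> together with an arbitrary admissible set
  of indices below \<open>n - f n\<close>, so \<open>a (n + 1) = a n + a (n - f n)\<close>. By induction the sums of the
  admissible sets below \<open>n\<close> fill exactly the interval \<open>[0, a n)\<close>: the sets without \<open>n\<close> give
  \<open>[0, a n)\<close>, and those with \<open>n\<close> give the adjacent interval \<open>[a n, a n + a (n - f n))\<close>.
  There are \<open>a n\<close> such sets and \<open>a n\<close> such values, so no value occurs twice. Since \<open>a\<close> is
  strictly increasing, every number lies in \<open>[0, a n)\<close> for some \<open>n\<close>.
\<close>

definition admissible_below :: "(nat \<Rightarrow> nat) \<Rightarrow> nat \<Rightarrow> nat set set" where
  "admissible_below f n =
     {S. S \<subseteq> {..<n} \<and> (\<forall>m\<in>S. \<forall>j. m \<le> j + f m \<and> j < m \<longrightarrow> j \<notin> S)}"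

definition admissible_count :: "(nat \<Rightarrow> nat) \<Rightarrow> nat \<Rightarrow> nat" where
  "admissible_count f n = card (admissible_below f n)"

lemma finite_admissible_below: "finite (admissible_below f n)"
  by (rule finite_subset[of _ "Pow {..<n}"]) (auto simp: admissible_below_def)

lemma admissible_below_0: "admissible_below f 0 = {{}}"
  by (auto simp: admissible_below_def)

lemma admissible_below_mono: "m \<le> n \<Longrightarrow> admissible_below f m \<subseteq> admissible_below f n"
  by (force simp: admissible_below_def)

lemma admissible_below_ex_iff:
  "(\<exists>n. S \<in> admissible_below f n) \<longleftrightarrow>
     finite S \<and> (\<forall>m\<in>S. \<forall>j. m \<le> j + f m \<and> j < m \<longrightarrow> j \<notin> S)"
  unfolding admissible_below_def
  by (auto simp: finite_nat_set_iff_bounded subset_eq)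

text \<open>
  An index \<open>n\<close> excludes precisely the smaller indices from \<open>n - f n\<close> on. Truncated subtraction
  is the right reading here: if \<open>f n \<ge> n\<close>, then \<open>n\<close> excludes all smaller indices.
\<close>

lemma admissible_below_Suc:
  "admissible_below f (Suc n) =
     admissible_below f n \<union> insert n ` admissible_below f (n - f n)"
proof (intro equalityI subsetI)
  fix S assume S: "S \<in> admissible_below f (Suc n)"
  show "S \<in> admissible_below f n \<union> insert n ` admissible_below f (n - f n)"
  proof (cases "n \<in> S")
    case True
    have "j < n - f n" if "j \<in> S - {n}" for j
    proof -
      have "j < n" "\<not> n \<le> j + f n"
        using S that True by (auto simp: admissible_below_def less_Suc_eq)
      then show ?thesis by linarith
    qed
    then have "S - {n} \<in> admissible_below f (n - f n)"
      using S by (auto simp: admissible_below_def)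
    then have "insert n (S - {n}) \<in> insert n ` admissible_below f (n - f n)"
      by (rule imageI)
    then show ?thesis using True by (simp add: insert_absorb)
  next
    case False
    then have "S \<in> admissible_below f n"
      using S by (auto simp: admissible_below_def less_Suc_eq)
    then show ?thesis ..
  qed
next
  fix S assume "S \<in> admissible_below f n \<union> insert n ` admissible_below f (n - f n)"
  then consider "S \<in> admissible_below f n"
    | T where "T \<in> admissible_below f (n - f n)" "S = insert n T"
    by auto
  then show "S \<in> admissible_below f (Suc n)"
  proof cases
    case 1
    then show ?thesis using admissible_below_mono[of n "Suc n" f] by auto
  next
    case 2
    then have "j < n \<and> \<not> n \<le> j + f n" if "j \<in> T" for j
      using that by (force simp: admissible_below_def)
    with 2 show ?thesis
      by (fastforce simp: admissible_below_def)
  qed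
qed

lemma admissible_below_no_index_ge:
  "T \<in> admissible_below f m \<Longrightarrow> m \<le> n \<Longrightarrow> n \<notin> T"
  by (auto simp: admissible_below_def)

lemma admissible_count_Suc:
  "admissible_count f (Suc n) = admissible_count f n + admissible_count f (n - f n)"
proof -
  have "inj_on (insert n) (admissible_below f (n - f n))"
    by (intro inj_onI) (metis admissible_below_no_index_ge diff_le_self insert_ident)
  moreover have "admissible_below f n \<inter> insert n ` admissible_below f (n - f n) = {}"
    by (auto simp: admissible_below_def)
  ultimately show ?thesis
    by (simp add: admissible_count_def admissible_below_Suc card_Un_disjoint
        finite_admissible_below card_image)
qed

lemma admissible_count_pos: "admissible_count f n > 0"
proof -
  have "{} \<in> admissible_below f n" by (simp add: admissible_below_def)
  then show ?thesis
    unfolding admissible_count_def using finite_admissible_below by (auto simp: card_gt_0_iff)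
qed

lemma less_admissible_count: "n < admissible_count f n"
proof (induction n)
  case 0
  show ?case by (rule admissible_count_pos)
next
  case (Suc n)
  then show ?case using admissible_count_pos[of f "n - f n"] by (simp add: admissible_count_Suc)
qed

text \<open>
  The induction must be strong: the sets containing the largest index \<open>n\<close> appeal to the
  statement for \<open>n - f n\<close>, and the resulting block of sums is that interval shifted by the
  \<open>n\<close>-th term, so that it starts exactly where the sums without \<open>n\<close> stop.
\<close>

lemma sums_of_admissible_sets:
  "sum (admissible_count f) ` admissible_below f n = {..<admissible_count f n}"
proof (induction n rule: less_induct)
  case (less n)
  show ?case
  proof (cases n)
    case 0
    then show ?thesis by (auto simp: admissible_below_0 admissible_count_def)
  next
    case (Suc k)
    let ?a = "admissible_count f" and ?r = "k - f k"
    have "sum ?a (insert k T) = ?a k + sum ?a T" if "T \<in> admissible_below f ?r" for T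
    proof -
      have "finite T"
        using that by (auto simp: admissible_below_def intro: finite_subset)
      then show ?thesis using admissible_below_no_index_ge[OF that, of k] by simp
    qed
    then have "sum ?a ` insert k ` admissible_below f ?r
        = (+) (?a k) ` sum ?a ` admissible_below f ?r"
      by (simp add: image_image cong: image_cong)
    also have "\<dots> = {?a k..<?a k + ?a ?r}"
      using less.IH[of ?r] Suc by (simp add: lessThan_atLeast0 add.commute)
    finally have with_k:
      "sum ?a ` insert k ` admissible_below f ?r = {?a k..<?a k + ?a ?r}" .
    have "sum ?a ` admissible_below f k = {..<?a k}"
      using less.IH[of k] Suc by simp
    with with_k show ?thesis
      by (auto simp: Suc admissible_below_Suc admissible_count_Suc image_Un)
  qed
qed

text \<open>
  The map taking an admissible set to its sum is onto a set with as many elements as its domain.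
\<close>

lemma inj_on_sum_admissible:
  "inj_on (sum (admissible_count f)) (admissible_below f n)"
  by (rule eq_card_imp_inj_on[OF finite_admissible_below])
    (simp only: sums_of_admissible_sets card_lessThan flip: admissible_count_def)

lemma f_decomposition_iff_admissible:
  "f_decomposition f a x S \<longleftrightarrow> x = sum a S \<and> (\<exists>n. S \<in> admissible_below f n)"
  unfolding f_decomposition_def admissible_below_ex_iff by auto

theorem theorem1p2:
  fixes f :: "nat \<Rightarrow> nat"
  shows "\<exists>a :: nat \<Rightarrow> nat. (\<forall>n. a n > 0) \<and>
           (\<forall>x > 0. \<exists>!S. f_decomposition f a x S)"
proof (intro exI[of _ "admissible_count f"] conjI allI impI)
  show "admissible_count f n > 0" for n by (rule admissible_count_pos)
next
  fix x :: nat
  let ?a = "admissible_count f"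
  have "x \<in> sum ?a ` admissible_below f x"
    by (simp add: sums_of_admissible_sets less_admissible_count)
  then have "\<exists>S. f_decomposition f ?a x S"
    by (auto simp: f_decomposition_iff_admissible)
  moreover have "S = T" if dec: "f_decomposition f ?a x S" "f_decomposition f ?a x T" for S T
  proof -
    obtain m n where "S \<in> admissible_below f m" "T \<in> admissible_below f n"
      and sums: "sum ?a S = sum ?a T"
      using dec unfolding f_decomposition_iff_admissible by metis
    then have "S \<in> admissible_below f (max m n)" "T \<in> admissible_below f (max m n)"
      using admissible_below_mono[of m "max m n" f] admissible_below_mono[of n "max m n" f]
      by auto
    with sums show "S = T" by (rule inj_onD[OF inj_on_sum_admissible])
  qed
  ultimately show "\<exists>!S. f_decomposition f ?a x S" by blast
qed

end
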